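(* Let $D$ be the $n\times n$ boundary matrix over a field $\mathbb{F}$ of a filtration $\emptyset=K_0\subset K_1\subset\dots\subset K_n=K$ of simplicial complexes in which each $K_i\setminus K_{i-1}$ is a single simplex. Run the recursive column algorithm (defined in the context) on $D$ and let $R$ be the $n\times n$ matrix it outputs. Then the persistence diagram read off from $R$, $$\{(i,j) : R[\cdot,j]\neq 0,\ i=\mathrm{low}_R(j)\}\ \cup\ \{(i,\infty) : R[\cdot,i]=0 \text{ and } i\neq \mathrm{low}_R(j)\text{ for all } j\},$$ is the persistence diagram of the filtration.
   Context: $\mathbb{F}$ is a fixed finite field. The boundary matrix $D$ has rows and columns indexed by the simplices in order of appearance: column $j$ is the simplicial boundary of $\sigma_j=K_j\setminus K_{j-1}$ written in the basis $\sigma_1,\dots,\sigma_n$. $M[I,J]$ denotes the submatrix of $M$ with rows $I$ and columns $J$ (in the given order of the index sequences), and $\cdot$ means all indices. For a matrix $R$ and a nonzero column $R[\cdot,j]$, $\mathrm{low}_R(j)=\max\{i : R[i,j]\neq0\}$ (the pivot of column $j$); it is undefined for a zero column. Persistence diagram of the filtration: take any decomposition $R'=D V'$ with $V'$ invertible upper-triangular and $R'$ column-reduced (distinct nonzero columns of $R'$ have distinct $\mathrm{low}_{R'}$ values); the diagram is $\{(i,j): R'[\cdot,j]\ne 0,\ i=\mathrm{low}_{R'}(j)\}\cup\{(i,\infty): R'[\cdot,i]=0,\ i\neq \mathrm{low}_{R'}(j)\ \forall j\}$. It is independent of the chosen decomposition. Recursive column algorithm. Fix $N\ge n$ and initialize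 $$R=\begin{bmatrix} D&0\\0&I_N\end{bmatrix},\qquad V=I_{n+N},\qquad Z=\emptyset .$$ The procedure $\mathrm{Col}(i,j)$, for integers $1\le i\le j\le n$, modifies $R,V,Z$ as follows, with $\mathrm{low}=\mathrm{low}_R$ for the current $R$. (1) If $i=j$: if $R[\cdot,i]=0$, let $\ell$ be the smallest index $\ell>n$ with $R[\cdot,\ell]\neq0$, swap columns $i$ and $\ell$ (in $R$ and in $V$), and add $i$ to $Z$; otherwise do nothing. (2) If $i<j$: let $B$ be the set of integers in $[i,(i+j)/2)$ and $C$ the set of integers in $[(i+j)/2,j]$. Call $\mathrm{Col}$ on the interval $B$. Let $L$ be the sequence $(\mathrm{low}(b))_{b\in B}$ in increasing order of $b$, and $\bar L$ the remaining row indices. Compute $\Lambda=R[L,B]^{-1}R[L,C]$ and update $R[\bar L,C]\leftarrow R[\bar L,C]-R[\bar L,B]\Lambda$, $R[L,C]\leftarrow 0$, $V[\cdot,C]\leftarrow V[\cdot,C]-V[\cdot,B]\Lambda$. Then call $\mathrm{Col}$ on the interval $C$. The algorithm runs $\mathrm{Col}(1,n)$, then undoes all the column swaps (in reverse order), and outputs the restriction of $R$ to its first $n$ rows and first $n$ columns. *)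

theory Defs
  imports
    "Jordan_Normal_Form.Gauss_Jordan_Elimination"
    "Jordan_Normal_Form.Column_Operations"
    "HOL-Library.Extended_Nat"
    "HOL-Library.Monad_Syntax"
begin

text \<open>
  All indices are 0-based, as is usual for \<^type>\<open>mat\<close>: the simplices of the filtration are
  \<open>\<sigma>\<^sub>0, \<dots>, \<sigma>\<^sub>n\<^sub>-\<^sub>1\<close>, where \<open>\<sigma>\<^sub>j\<close> is the simplex added in passing from \<open>K j\<close> to \<open>K (Suc j)\<close>, and the
  additional rows and columns of the algorithm have the indices \<open>n, \<dots>, n + N - 1\<close>.
\<close>

section \<open>Filtrations and their boundary matrices\<close>

definition simplicial_complex :: "'v set set \<Rightarrow> bool" where
  "simplicial_complex X \<longleftrightarrow>
     (\<forall>\<sigma>\<in>X. finite \<sigma> \<and> \<sigma> \<noteq> {} \<and> (\<forall>\<tau>. \<tau> \<subseteq> \<sigma> \<and> \<tau> \<noteq> {} \<longrightarrow> \<tau> \<in> X))"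

definition filtration :: "nat \<Rightarrow> (nat \<Rightarrow> 'v set set) \<Rightarrow> bool" where
  "filtration n K \<longleftrightarrow>
     K 0 = {} \<and> (\<forall>i\<le>n. simplicial_complex (K i)) \<and>
     (\<forall>i<n. K i \<subset> K (Suc i) \<and> is_singleton (K (Suc i) - K i))"

definition simplex :: "(nat \<Rightarrow> 'v set set) \<Rightarrow> nat \<Rightarrow> 'v set" where
  "simplex K j = the_elem (K (Suc j) - K j)"

text \<open>
  The coefficient of \<open>\<tau>\<close> in the boundary of \<open>\<sigma>\<close>. Simplices are oriented by the order of the
  vertices: for \<open>\<sigma> = [v\<^sub>0 < \<dots> < v\<^sub>k]\<close> the face omitting \<open>v\<^sub>q\<close> has the sign \<open>(-1)^q\<close>.
\<close>
definition boundary_coeff :: "'v::linorder set \<Rightarrow> 'v set \<Rightarrow> 'a::field" where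
  "boundary_coeff \<sigma> \<tau> = (\<Sum>v\<in>\<sigma>. if \<tau> = \<sigma> - {v} then (-1) ^ card {u\<in>\<sigma>. u < v} else 0)"

definition boundary_matrix :: "nat \<Rightarrow> (nat \<Rightarrow> 'v::linorder set set) \<Rightarrow> 'a::field mat" where
  "boundary_matrix n K = mat n n (\<lambda>(i, j). boundary_coeff (simplex K j) (simplex K i))"

section \<open>Persistence diagrams\<close>

definition zero_col :: "'a::zero mat \<Rightarrow> nat \<Rightarrow> bool" where
  "zero_col R j \<longleftrightarrow> col R j = 0\<^sub>v (dim_row R)"

text \<open>Only meaningful when column \<open>j\<close> is nonzero; all uses are guarded accordingly.\<close>
definition low :: "'a::zero mat \<Rightarrow> nat \<Rightarrow> nat" where
  "low R j = Max {i. i < dim_row R \<and> R $$ (i, j) \<noteq> 0}"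

definition diagram :: "'a::zero mat \<Rightarrow> (nat \<times> enat) set" where
  "diagram R =
     {(i, enat j) | i j. j < dim_col R \<and> \<not> zero_col R j \<and> i = low R j} \<union>
     {(i, \<infinity>) | i. i < dim_col R \<and> zero_col R i \<and>
        (\<forall>j<dim_col R. \<not> zero_col R j \<longrightarrow> i \<noteq> low R j)}"

definition column_reduced :: "'a::zero mat \<Rightarrow> bool" where
  "column_reduced R \<longleftrightarrow>
     (\<forall>j<dim_col R. \<forall>k<dim_col R.
        j \<noteq> k \<and> \<not> zero_col R j \<and> \<not> zero_col R k \<longrightarrow> low R j \<noteq> low R k)"

definition reduction :: "'a::field mat \<Rightarrow> 'a mat \<Rightarrow> 'a mat \<Rightarrow> bool" where
  "reduction D R V \<longleftrightarrow>
     V \<in> carrier_mat (dim_col D) (dim_col D) \<and> invertible_mat V \<and> upper_triangular V \<and>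
     R = D * V \<and> column_reduced R"

text \<open>
  The common diagram of all reductions of the boundary matrix. The description is proper since
  a reduction exists and its diagram does not depend on the choice. The first argument
  only carries the type of the coefficient field.
\<close>
definition persistence_diagram ::
    "'a::field itself \<Rightarrow> nat \<Rightarrow> (nat \<Rightarrow> 'v::linorder set set) \<Rightarrow> (nat \<times> enat) set" where
  "persistence_diagram _ n K =
     (THE P. \<exists>R V. reduction (boundary_matrix n K :: 'a mat) R V \<and> P = diagram R)"

section \<open>The recursive column algorithm\<close>

text \<open>
  The submatrix \<open>M[I,J]\<close> for index sequences \<open>I\<close>, \<open>J\<close>, and the assignment \<open>M[I,J] \<leftarrow> X\<close>, which is
  used for sequences without repetitions only.
\<close>
definition submat :: "'a mat \<Rightarrow> nat list \<Rightarrow> nat list \<Rightarrow> 'a mat" where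
  "submat M I J = mat (length I) (length J) (\<lambda>(p, q). M $$ (I ! p, J ! q))"

definition pos :: "nat list \<Rightarrow> nat \<Rightarrow> nat" where
  "pos I r = (LEAST p. I ! p = r)"

definition assign :: "'a mat \<Rightarrow> nat list \<Rightarrow> nat list \<Rightarrow> 'a mat \<Rightarrow> 'a mat" where
  "assign M I J X = mat (dim_row M) (dim_col M)
     (\<lambda>(r, c). if r \<in> set I \<and> c \<in> set J then X $$ (pos I r, pos J c) else M $$ (r, c))"

text \<open>
  A state \<open>(R, V, Z, S)\<close> consists of the data \<open>R\<close>, \<open>V\<close>, \<open>Z\<close> of the algorithm and the log \<open>S\<close> of the
  column swaps, the most recent one first. A step that cannot be carried out (no nonzero column to
  swap with, an undefined pivot, a singular block) makes the algorithm fail with \<^const>\<open>None\<close>.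
\<close>
type_synonym 'a state = "'a mat \<times> 'a mat \<times> nat set \<times> (nat \<times> nat) list"

fun col_leaf :: "nat \<Rightarrow> nat \<Rightarrow> 'a::field state \<Rightarrow> 'a state option" where
  "col_leaf n i (R, V, Z, S) =
     (if zero_col R i then
        if \<exists>l. n \<le> l \<and> l < dim_col R \<and> \<not> zero_col R l then
          let l = (LEAST l. n \<le> l \<and> l < dim_col R \<and> \<not> zero_col R l)
          in Some (swapcols i l R, swapcols i l V, insert i Z, (i, l) # S)
        else None
      else Some (R, V, Z, S))"

fun col_update :: "nat list \<Rightarrow> nat list \<Rightarrow> 'a::field state \<Rightarrow> 'a state option" where
  "col_update B C (R, V, Z, S) =
     (if \<exists>b\<in>set B. zero_col R b then None
      else
        let L = map (low R) B;
            L' = filter (\<lambda>r. r \<notin> set L) [0..<dim_row R];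
            A = [0..<dim_row V]
        in do {
          Inv \<leftarrow> mat_inverse (submat R L B);
          let \<Lambda> = Inv * submat R L C;
          let R' = assign R L' C (submat R L' C - submat R L' B * \<Lambda>);
          let R'' = assign R' L C (0\<^sub>m (length L) (length C));
          let V' = assign V A C (submat V A C - submat V A B * \<Lambda>);
          Some (R'', V', Z, S)
        })"

text \<open>
  The procedure \<open>Col(i, j)\<close> is \<open>col_rec n i (j + 1)\<close>: intervals are half-open. The integers in
  \<open>[i, (i+j)/2)\<close> and \<open>[(i+j)/2, j]\<close> are those in \<open>[i..<m]\<close> and \<open>[m..<j+1]\<close> for
  \<open>m = \<lceil>(i+j)/2\<rceil> = (i + (j + 1)) div 2\<close>; the passage to 0-based indices, which subtracts 1 from
  each of \<open>i\<close>, \<open>j\<close> and \<open>m\<close>, respects this splitting. Empty intervals occur for \<open>n = 0\<close> only.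
\<close>
function col_rec :: "nat \<Rightarrow> nat \<Rightarrow> nat \<Rightarrow> 'a::field state \<Rightarrow> 'a state option" where
  "col_rec n a b s =
     (if b \<le> a then Some s
      else if b = Suc a then col_leaf n a s
      else
        let m = (a + b) div 2
        in do {
          s1 \<leftarrow> col_rec n a m s;
          s2 \<leftarrow> col_update [a..<m] [m..<b] s1;
          col_rec n m b s2
        })"
  by pat_completeness auto
termination by (relation "measure (\<lambda>(n, a, b, s). b - a)") auto

definition initial_state :: "nat \<Rightarrow> 'a::field mat \<Rightarrow> 'a state" where
  "initial_state N D =
     (let n = dim_row D
      in (four_block_mat D (0\<^sub>m n N) (0\<^sub>m N n) (1\<^sub>m N), 1\<^sub>m (n + N), {}, []))"

definition undo_swaps :: "(nat \<times> nat) list \<Rightarrow> 'a mat \<Rightarrow> 'a mat" where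
  "undo_swaps S M = fold (\<lambda>(i, l). swapcols i l) S M"

definition recursive_column_algorithm :: "nat \<Rightarrow> 'a::field mat \<Rightarrow> 'a mat option" where
  "recursive_column_algorithm N D =
     (let n = dim_row D
      in do {
        (R, V, Z, S) \<leftarrow> col_rec n 0 n (initial_state N D);
        Some (submat (undo_swaps S R) [0..<n] [0..<n])
      })"

end

theory Submission
  imports Defs "Jordan_Normal_Form.Determinant"
begin

text \<open>
  The theorem is a fact about square matrices: for every square matrix \<open>D\<close> the algorithm outputs a
  matrix \<open>D V\<close> that is column-reduced, with \<open>V\<close> upper unitriangular
  (\<open>recursive_column_algorithm_reduction\<close>), and the diagram of such a matrix depends on \<open>D\<close> only
  (\<open>reduction_diagram_unique\<close>).

  The latter holds because the pivot of a linear combination of the columns of a column-reduced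
  matrix is at least the pivot of each nonzero column that occurs in it: of these columns, the one
  with the largest pivot does not cancel (\<open>no_cancellation_above_pivot\<close>). Two reductions of the
  same \<open>D\<close> differ by an invertible upper triangular factor, so that column \<open>j\<close> of each of them
  occurs in the combination that gives column \<open>j\<close> of the other. Thus neither of the two pivots
  exceeds the other.

  For the former, call a pivot row cleared if it is zero in all later columns under consideration.
  When the recursion enters an interval, the pivot rows of all columns before it are cleared in
  the interval. The block step clears the pivot rows of the first half \<open>B\<close> in the second half
  \<open>C\<close>, and it keeps the older pivot rows cleared, because these rows vanish on \<open>B\<close> as well.
  Since the columns of \<open>B\<close> have already been cleared against each other, the block \<open>R[L,B]\<close> is
  lower triangular with nonzero diagonal, so that the step can be carried out. At a leaf, a
  zero column is replaced by a unit vector \<open>e\<^sub>l\<close> with \<open>l \<ge> n\<close>, whose row \<open>l\<close> is zero in all other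
  columns. At the end all of the first \<open>n\<close> columns are nonzero and their pivot rows are cleared,
  hence the pivots are distinct.

  The swaps do no harm. Clearing the row \<open>l\<close>, which is already zero elsewhere, takes the
  coefficient zero, so that a swapped-in unit vector is never added to another column. Hence
  column \<open>j\<close>, if it was not swapped, is always of the form \<open>D v\<close>, where the last nonzero entry of \<open>v\<close>
  is \<open>v\<^sub>j = 1\<close>. A swapped column was also of this form, and zero, when it was swapped out, and
  undoing the swaps makes it zero again.
\<close>

section \<open>Pivots\<close>

lemma mult_mat_vec_nth:
  assumes "i < dim_row A" and "dim_vec v = dim_col A"
  shows "(A *\<^sub>v v) $ i = (\<Sum>k<dim_col A. A $$ (i, k) * v $ k)"
  using assms by (auto simp: scalar_prod_def lessThan_atLeast0 intro!: sum.cong)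

lemma zero_col_iff:
  assumes "j < dim_col R"
  shows "zero_col R j \<longleftrightarrow> (\<forall>i<dim_row R. R $$ (i, j) = 0)"
  using assms unfolding zero_col_def by (auto simp: vec_eq_iff)

lemma
  assumes "j < dim_col R" and "\<not> zero_col R j"
  shows low_less: "low R j < dim_row R" and low_nonzero: "R $$ (low R j, j) \<noteq> 0"
proof -
  let ?I = "{i. i < dim_row R \<and> R $$ (i, j) \<noteq> 0}"
  have "?I \<noteq> {}" using assms by (auto simp: zero_col_iff)
  then have "Max ?I \<in> ?I" by (intro Max_in) auto
  then show "low R j < dim_row R" "R $$ (low R j, j) \<noteq> 0" by (auto simp: low_def)
qed

lemma le_low:
  assumes "i < dim_row R" and "R $$ (i, j) \<noteq> 0"
  shows "i \<le> low R j"
  using assms unfolding low_def by (intro Max_ge) auto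

lemma low_cong:
  assumes "dim_row R' = dim_row R" and "\<And>r. r < dim_row R \<Longrightarrow> R' $$ (r, j) = R $$ (r, j)"
  shows "low R' j = low R j"
  unfolding low_def using assms by (intro arg_cong[of _ _ Max]) auto

lemma low_eqI:
  assumes "r < dim_row R" and "R $$ (r, j) \<noteq> 0"
    and "\<And>i. i < dim_row R \<Longrightarrow> r < i \<Longrightarrow> R $$ (i, j) = 0"
  shows "low R j = r"
proof -
  have "i \<le> r" if "i < dim_row R" "R $$ (i, j) \<noteq> 0" for i
    using assms(3) that by (meson not_le)
  then show ?thesis unfolding low_def using assms by (intro Max_eqI) auto
qed

section \<open>Independence of the diagram from the reduction\<close>

text \<open>
  Among the columns that occur in the combination, the one with the largest pivot is alone in its
  pivot row, so that this entry does not cancel.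
\<close>
lemma no_cancellation_above_pivot:
  fixes R :: "'a::field mat"
  assumes red: "column_reduced R" and y: "dim_vec y = dim_col R"
    and j: "j < dim_col R" "y $ j \<noteq> 0" and r: "r < dim_row R" "R $$ (r, j) \<noteq> 0"
  shows "\<exists>i<dim_row R. r \<le> i \<and> (R *\<^sub>v y) $ i \<noteq> 0"
proof -
  define S where "S = {k. k < dim_col R \<and> y $ k \<noteq> 0 \<and> \<not> zero_col R k}"
  have jS: "j \<in> S" using j r by (auto simp: S_def zero_col_iff)
  have fin: "finite S" by (simp add: S_def)
  then have "Max (low R ` S) \<in> low R ` S" using jS by (intro Max_in) auto
  then obtain k where k: "k \<in> S" and "low R k = Max (low R ` S)" by auto
  with fin have max: "low R k' \<le> low R k" if "k' \<in> S" for k' using that by simp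
  have kS: "k < dim_col R" "y $ k \<noteq> 0" "\<not> zero_col R k" using k by (auto simp: S_def)
  have "R $$ (low R k, k') * y $ k' = 0" if k': "k' < dim_col R" "k' \<noteq> k" for k'
  proof (cases "k' \<in> S")
    case True
    then have "low R k' \<noteq> low R k"
      using red kS k' unfolding column_reduced_def S_def by auto
    with max[OF True] have "low R k' < low R k" by simp
    then show ?thesis using le_low[of "low R k" R k'] low_less[OF kS(1,3)] by force
  next
    case False
    then show ?thesis using k' low_less[OF kS(1,3)] by (auto simp: S_def zero_col_iff)
  qed
  then have "(\<Sum>k'<dim_col R. R $$ (low R k, k') * y $ k')
      = (\<Sum>k'<dim_col R. if k' = k then R $$ (low R k, k) * y $ k else 0)"
    by (intro sum.cong) auto
  also have "\<dots> = R $$ (low R k, k) * y $ k" using kS(1) by simp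
  finally have "(\<Sum>k'<dim_col R. R $$ (low R k, k') * y $ k') = R $$ (low R k, k) * y $ k" .
  moreover have "R $$ (low R k, k) * y $ k \<noteq> 0" using kS low_nonzero by auto
  ultimately have "(R *\<^sub>v y) $ low R k \<noteq> 0"
    using low_less[OF kS(1,3)] y by (subst mult_mat_vec_nth) auto
  moreover have "r \<le> low R k" using le_low[OF r] max[OF jS] by simp
  ultimately show ?thesis using low_less[OF kS(1,3)] by blast
qed

lemma invertible_mat_right_inverse:
  assumes V: "V \<in> carrier_mat n n" and "invertible_mat V"
  obtains W where "W \<in> carrier_mat n n" and "V * W = 1\<^sub>m n"
proof -
  obtain W where W: "V * W = 1\<^sub>m (dim_row V)" "W * V = 1\<^sub>m (dim_row W)"
    using assms(2) by (auto simp: invertible_mat_def inverts_mat_def)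
  have "dim_col W = n" using arg_cong[OF W(1), of dim_col] V by simp
  moreover have "dim_row W = n" using arg_cong[OF W(2), of dim_col] V by simp
  ultimately show ?thesis using that[of W] W(1) V by auto
qed

lemma invertible_upper_triangular_diag_nonzero:
  fixes V :: "'a::field mat"
  assumes V: "V \<in> carrier_mat n n" and "invertible_mat V" "upper_triangular V" and k: "k < n"
  shows "V $$ (k, k) \<noteq> 0"
proof -
  obtain W where "W \<in> carrier_mat n n" and VW: "V * W = 1\<^sub>m n"
    using invertible_mat_right_inverse[OF assms(1,2)] .
  then have "det V * det W = 1" using det_mult[OF V] VW by (metis det_one)
  then have "det V \<noteq> 0" by auto
  then have "prod_list (diag_mat V) \<noteq> 0" using det_upper_triangular[OF assms(3) V] by simp
  then show ?thesis using V k by (auto simp: prod_list_zero_iff diag_mat_def image_iff)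
qed

text \<open>
  This replaces the inverse of \<open>V\<close> being upper triangular: if \<open>t\<close> is the position of the last
  nonzero entry of \<open>y\<close>, then \<open>(V y)\<^sub>t = V\<^sub>t\<^sub>t y\<^sub>t\<close>, and the later entries of \<open>V y\<close> vanish. Hence \<open>t\<close> is also the position of the last nonzero entry of
  \<open>V y\<close>.
\<close>
lemma upper_triangular_preimage_last_entry:
  fixes V :: "'a::field mat"
  assumes V: "V \<in> carrier_mat n n" "upper_triangular V" and diag: "\<And>k. k < n \<Longrightarrow> V $$ (k, k) \<noteq> 0"
    and y: "dim_vec y = n" and x: "V *\<^sub>v y = x"
    and j: "j < n" "x $ j \<noteq> 0" and above: "\<And>k. j < k \<Longrightarrow> k < n \<Longrightarrow> x $ k = 0"
  shows "y $ j \<noteq> 0"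
proof -
  have x_nth: "x $ i = (\<Sum>k<n. V $$ (i, k) * y $ k)" if "i < n" for i
    using that V y x mult_mat_vec_nth[of i V y] by auto
  define T where "T = {k. k < n \<and> y $ k \<noteq> 0}"
  have "T \<noteq> {}" using x_nth[OF j(1)] j(2) by (fastforce simp: T_def intro: sum.neutral)
  define t where "t = Max T"
  have fin: "finite T" by (simp add: T_def)
  have t: "t < n" "y $ t \<noteq> 0"
    using Max_in[OF fin \<open>T \<noteq> {}\<close>] by (auto simp: T_def t_def)
  have y0: "y $ k = 0" if "t < k" "k < n" for k
  proof (rule ccontr)
    assume "y $ k \<noteq> 0"
    then have "k \<in> T" using that by (simp add: T_def)
    then have "k \<le> t" unfolding t_def using fin by simp
    then show False using that by simp
  qed
  have V0: "V $$ (i, k) = 0" if "k < i" "i < n" for i k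
    using V that by auto
  have "x $ t = V $$ (t, t) * y $ t"
  proof -
    have "V $$ (t, k) * y $ k = 0" if "k < n" "k \<noteq> t" for k
      using y0[of k] V0[of k t] that t by (cases "k < t") auto
    then have "x $ t = (\<Sum>k<n. if k = t then V $$ (t, t) * y $ t else 0)"
      unfolding x_nth[OF t(1)] by (intro sum.cong) auto
    then show ?thesis using t by simp
  qed
  then have "x $ t \<noteq> 0" using diag t by auto
  then have "t \<le> j" using above t by (meson not_le)
  moreover have "\<not> t < j"
  proof
    assume "t < j"
    then have "V $$ (j, k) * y $ k = 0" if "k < n" for k
      using y0[of k] V0[of k j] j that by (cases "k < j") auto
    then have "x $ j = 0" unfolding x_nth[OF j(1)] by (intro sum.neutral) auto
    then show False using j(2) by simp
  qed
  ultimately show ?thesis using t by simp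
qed

text \<open>
  Column \<open>j\<close> of \<open>R' = D V'\<close> is \<open>R y\<close> for \<open>y = V\<^sup>-\<^sup>1 V' e\<^sub>j\<close>, and \<open>y\<close> has a nonzero entry \<open>j\<close>. The nonzero
  entry \<open>i\<close> of \<open>R y\<close> then exists because the columns of \<open>R\<close> do not cancel.
\<close>
lemma reduction_pivot_minimal:
  fixes D :: "'a::field mat"
  assumes red: "reduction D R V" "reduction D R' V'" and j: "j < dim_col D"
    and r: "r < dim_row D" "R $$ (r, j) \<noteq> 0"
  shows "\<exists>i<dim_row D. r \<le> i \<and> R' $$ (i, j) \<noteq> 0"
proof -
  let ?n = "dim_col D"
  have V: "V \<in> carrier_mat ?n ?n" "upper_triangular V" "invertible_mat V"
    and V': "V' \<in> carrier_mat ?n ?n" "upper_triangular V'" "invertible_mat V'"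
    and R: "R = D * V" "R' = D * V'" "column_reduced R"
    using red by (auto simp: reduction_def)
  obtain W where W: "W \<in> carrier_mat ?n ?n" and VW: "V * W = 1\<^sub>m ?n"
    using invertible_mat_right_inverse[OF V(1,3)] .
  define x where "x = col V' j"
  define y where "y = W *\<^sub>v x"
  have x: "x \<in> carrier_vec ?n" using V' unfolding x_def by (intro carrier_vecI) simp
  have y: "y \<in> carrier_vec ?n" using W unfolding y_def by (intro carrier_vecI) simp
  have Vy: "V *\<^sub>v y = x"
    unfolding y_def using assoc_mult_mat_vec[OF V(1) W x] VW x by simp
  have "y $ j \<noteq> 0"
  proof (rule upper_triangular_preimage_last_entry[OF V(1,2) _ _ Vy j])
    show "V $$ (k, k) \<noteq> 0" if "k < ?n" for k
      using invertible_upper_triangular_diag_nonzero[OF V(1,3,2) that] .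
    show "x $ j \<noteq> 0"
      using invertible_upper_triangular_diag_nonzero[OF V'(1,3,2) j] j V' by (simp add: x_def)
    show "x $ k = 0" if "j < k" "k < ?n" for k
      using V' that j by (auto simp: x_def)
  qed (use y in auto)
  then obtain i where i: "i < dim_row R" "r \<le> i" "(R *\<^sub>v y) $ i \<noteq> 0"
    using no_cancellation_above_pivot[OF R(3), of y j r] y j r R V by auto
  have "R *\<^sub>v y = D *\<^sub>v x"
    unfolding R(1) using assoc_mult_mat_vec[OF carrier_matI[OF refl refl] V(1) y] Vy by simp
  also have "\<dots> = col R' j"
    unfolding x_def R(2) using V' j by auto
  finally show ?thesis using i R V V' j by auto
qed

lemma reduction_diagram_unique:
  fixes D :: "'a::field mat"
  assumes red: "reduction D R V" "reduction D R' V'"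
  shows "diagram R = diagram R'"
proof -
  have dims: "dim_row R = dim_row D" "dim_col R = dim_col D"
    "dim_row R' = dim_row D" "dim_col R' = dim_col D"
    using red by (auto simp: reduction_def)
  have zero: "zero_col R j \<longleftrightarrow> zero_col R' j" if "j < dim_col D" for j
    using reduction_pivot_minimal[OF red that] reduction_pivot_minimal[OF red(2,1) that] that
    by (auto simp: zero_col_iff dims)
  have le: "low R1 j \<le> low R2 j"
    if "reduction D R1 V1" "reduction D R2 V2" "j < dim_col D" "\<not> zero_col R1 j"
    for R1 R2 V1 V2 :: "'a mat" and j
  proof -
    have d: "dim_row R1 = dim_row D" "dim_col R1 = dim_col D" "dim_row R2 = dim_row D"
      using that by (auto simp: reduction_def)
    show ?thesis
      using reduction_pivot_minimal[OF that(1-3), of "low R1 j"] low_less[of j R1]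
        low_nonzero[of j R1] le_low[of _ R2 j] that d by (metis le_trans)
  qed
  have "low R j = low R' j" if "j < dim_col D" "\<not> zero_col R' j" for j
    using le[OF red that(1)] le[OF red(2,1) that] zero that by auto
  with zero show ?thesis unfolding diagram_def dims
    by (simp cong: conj_cong imp_cong)
qed

section \<open>Unitriangular column operations\<close>

text \<open>
  The vector \<open>w\<close> is column \<open>j\<close> of \<open>D\<close> plus a linear combination of earlier columns. Vectors are
  functions here, so that a column \<open>\<lambda>r. R $$ (r, j)\<close> of a matrix with more rows than \<open>D\<close> can be
  used directly: only its first entries matter.
\<close>
definition monic_combination :: "'a::field mat \<Rightarrow> nat \<Rightarrow> (nat \<Rightarrow> 'a) \<Rightarrow> bool" where
  "monic_combination D j w \<longleftrightarrow>
     (\<exists>v. v j = 1 \<and> (\<forall>k>j. v k = 0) \<and>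
        (\<forall>r<dim_row D. w r = (\<Sum>k<dim_col D. D $$ (r, k) * v k)))"

lemma monic_combination_col:
  "j < dim_col D \<Longrightarrow> monic_combination D j (\<lambda>r. D $$ (r, j))"
  unfolding monic_combination_def
  by (intro exI[of _ "\<lambda>k. if k = j then 1 else 0"]) (auto simp: if_distrib cong: if_cong)

lemma monic_combination_cong:
  assumes "\<And>r. r < dim_row D \<Longrightarrow> w r = w' r"
  shows "monic_combination D j w \<longleftrightarrow> monic_combination D j w'"
  unfolding monic_combination_def using assms by auto

lemma monic_combination_diff:
  assumes w: "monic_combination D j w" and B: "finite B"
    and u: "\<And>b. b \<in> B \<Longrightarrow> b < j \<and> monic_combination D b (u b)"
  shows "monic_combination D j (\<lambda>r. w r - (\<Sum>b\<in>B. u b r * c b))"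
proof -
  obtain x where x: "x j = 1" "\<forall>k>j. x k = 0"
    "\<And>r. r < dim_row D \<Longrightarrow> w r = (\<Sum>k<dim_col D. D $$ (r, k) * x k)"
    using w by (auto simp: monic_combination_def)
  have "\<forall>b\<in>B. \<exists>y. (\<forall>k>b. y k = 0) \<and>
      (\<forall>r<dim_row D. u b r = (\<Sum>k<dim_col D. D $$ (r, k) * y k))"
    using u unfolding monic_combination_def by blast
  then obtain y where y: "\<And>b k. b \<in> B \<Longrightarrow> b < k \<Longrightarrow> y b k = 0"
    "\<And>b r. b \<in> B \<Longrightarrow> r < dim_row D \<Longrightarrow> u b r = (\<Sum>k<dim_col D. D $$ (r, k) * y b k)"
    by metis
  have y0: "y b k = 0" if "b \<in> B" "j \<le> k" for b k
    using y(1)[OF that(1), of k] u[OF that(1)] that by auto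
  define z where "z k = x k - (\<Sum>b\<in>B. y b k * c b)" for k
  have "w r - (\<Sum>b\<in>B. u b r * c b) = (\<Sum>k<dim_col D. D $$ (r, k) * z k)"
    if "r < dim_row D" for r
  proof -
    have "(\<Sum>b\<in>B. u b r * c b) = (\<Sum>b\<in>B. \<Sum>k<dim_col D. D $$ (r, k) * (y b k * c b))"
      using that by (intro sum.cong refl) (simp add: y(2) sum_distrib_right mult.assoc)
    also have "\<dots> = (\<Sum>k<dim_col D. D $$ (r, k) * (\<Sum>b\<in>B. y b k * c b))"
      by (subst sum.swap) (simp add: sum_distrib_left)
    finally show ?thesis
      using that by (simp add: x(3) z_def algebra_simps sum_subtractf)
  qed
  moreover have "z j = 1" "\<forall>k>j. z k = 0" using x y0 by (auto simp: z_def)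
  ultimately show ?thesis unfolding monic_combination_def by blast
qed

text \<open>
  It suffices to follow the columns one by one, without tracking a transformation matrix: the
  coefficient vectors together form an upper triangular matrix of determinant 1.
\<close>
lemma reduction_of_monic_combinations:
  fixes D :: "'a::field mat"
  assumes dims: "dim_row R = dim_row D" "dim_col R = dim_col D"
    and comb: "\<And>j. j < dim_col D \<Longrightarrow> monic_combination D j (\<lambda>r. R $$ (r, j))"
    and red: "column_reduced R"
  shows "\<exists>V. reduction D R V"
proof -
  let ?n = "dim_col D"
  have "\<forall>j<?n. \<exists>v. v j = 1 \<and> (\<forall>k>j. v k = 0) \<and>
        (\<forall>r<dim_row D. R $$ (r, j) = (\<Sum>k<?n. D $$ (r, k) * v k))"
    using comb by (auto simp: monic_combination_def)
  then obtain v where "\<forall>j<?n. v j j = 1 \<and> (\<forall>k>j. v j k = 0) \<and>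
        (\<forall>r<dim_row D. R $$ (r, j) = (\<Sum>k<?n. D $$ (r, k) * v j k))"
    unfolding choice_iff' by blast
  then have v: "\<And>j. j < ?n \<Longrightarrow> v j j = 1" "\<And>j k. j < ?n \<Longrightarrow> j < k \<Longrightarrow> v j k = 0"
    "\<And>j r. j < ?n \<Longrightarrow> r < dim_row D \<Longrightarrow> R $$ (r, j) = (\<Sum>k<?n. D $$ (r, k) * v j k)"
    by blast+
  define V where "V = mat ?n ?n (\<lambda>(k, j). v j k)"
  have V: "V \<in> carrier_mat ?n ?n" by (simp add: V_def)
  have tri: "upper_triangular V" using v by (auto simp: V_def)
  have "R = D * V"
    using dims v by (intro eq_matI)
      (auto simp: V_def scalar_prod_def lessThan_atLeast0)
  moreover have "invertible_mat V"
  proof -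
    have "det V \<noteq> 0"
      using det_upper_triangular[OF tri V] v(1) V
      by (auto simp: V_def prod_list_zero_iff diag_mat_def)
    then have "V \<in> Units (ring_mat TYPE('a) ?n ())"
      by (rule det_non_zero_imp_unit[OF V])
    then obtain W where "W \<in> carrier_mat ?n ?n" "V * W = 1\<^sub>m ?n" "W * V = 1\<^sub>m ?n"
      by (auto simp: Units_def ring_mat_def)
    then show ?thesis using V unfolding invertible_mat_def inverts_mat_def by auto
  qed
  ultimately have "reduction D R V"
    using V tri red by (simp add: reduction_def)
  then show ?thesis ..
qed

section \<open>The block elimination step\<close>

lemma pos_nth:
  assumes "distinct I" "p < length I"
  shows "pos I (I ! p) = p"
  unfolding pos_def
proof (rule Least_equality)
  show "p \<le> q" if "I ! q = I ! p" for q
    using nth_eq_iff_index_eq[OF assms(1), of q p] assms(2) that by (cases "q < length I") auto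
qed simp

lemma assign_nth:
  assumes "distinct I" "distinct J" "p < length I" "q < length J"
    and "I ! p < dim_row M" "J ! q < dim_col M"
  shows "assign M I J X $$ (I ! p, J ! q) = X $$ (p, q)"
  using assms by (simp add: assign_def pos_nth)

lemma assign_outside:
  assumes "r < dim_row M" "c < dim_col M" "r \<notin> set I \<or> c \<notin> set J"
  shows "assign M I J X $$ (r, c) = M $$ (r, c)"
  using assms by (auto simp: assign_def)

lemma dim_assign [simp]:
  "dim_row (assign M I J X) = dim_row M" "dim_col (assign M I J X) = dim_col M"
  by (simp_all add: assign_def)

lemma lower_triangular_mat_inverse:
  fixes A :: "'a::field mat"
  assumes A: "A \<in> carrier_mat k k" and "\<And>p q. p < q \<Longrightarrow> q < k \<Longrightarrow> A $$ (p, q) = 0"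
    and "\<And>p. p < k \<Longrightarrow> A $$ (p, p) \<noteq> 0"
  obtains B where "mat_inverse A = Some B" "A * B = 1\<^sub>m k" "B \<in> carrier_mat k k"
proof -
  have "det A \<noteq> 0"
    using det_lower_triangular[OF assms(2) A] assms(3) A
    by (auto simp: prod_list_zero_iff diag_mat_def)
  then have "A \<in> Units (ring_mat TYPE('a) k ())"
    by (rule det_non_zero_imp_unit[OF A])
  then have "mat_inverse A \<noteq> None"
    using mat_inverse(1)[OF A, where b = "()"] by blast
  then obtain B where "mat_inverse A = Some B" by blast
  then show ?thesis using mat_inverse(2)[OF A] that by blast
qed

text \<open>
  The assumption on \<open>low\<close> makes \<open>R[L,B]\<close> lower triangular, and the pivots are its diagonal entries.
  In the rows \<open>L\<close> the assigned zeros agree with the subtraction, since \<open>R[L,B] \<Lambda> = R[L,C]\<close>; hence one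
  formula describes the new columns in all rows.
\<close>
lemma col_update_eliminates:
  fixes R :: "'a::field mat"
  assumes B: "distinct B" "set B \<subseteq> {..<dim_col R}" and C: "distinct C" "set C \<subseteq> {..<dim_col R}"
    and nz: "\<And>b. b \<in> set B \<Longrightarrow> \<not> zero_col R b"
    and tri: "\<And>p q. p < q \<Longrightarrow> q < length B \<Longrightarrow> R $$ (low R (B ! p), B ! q) = 0"
  obtains R' V' c where "col_update B C (R, V, Z, S) = Some (R', V', Z, S)"
    and "dim_row R' = dim_row R" "dim_col R' = dim_col R"
    and "\<And>r j. r < dim_row R \<Longrightarrow> j < dim_col R \<Longrightarrow> j \<notin> set C \<Longrightarrow> R' $$ (r, j) = R $$ (r, j)"
    and "\<And>r j. r < dim_row R \<Longrightarrow> j \<in> set C \<Longrightarrow>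
           R' $$ (r, j) = R $$ (r, j) - (\<Sum>b\<in>set B. R $$ (r, b) * c b j)"
    and "\<And>b j. b \<in> set B \<Longrightarrow> j \<in> set C \<Longrightarrow> R' $$ (low R b, j) = 0"
proof -
  define k where "k = length B"
  define L where "L = map (low R) B"
  define L' where "L' = filter (\<lambda>r. r \<notin> set L) [0..<dim_row R]"
  define P where "P = submat R L B"
  have lenL: "length L = k" by (simp add: L_def k_def)
  have colB: "B ! p < dim_col R" "B ! p \<in> set B" if "p < k" for p
    using B(2) that nth_mem[of p B] unfolding k_def by blast+
  have L_less: "L ! p < dim_row R" if "p < k" for p
    using low_less[OF colB(1)[OF that] nz[OF colB(2)[OF that]]] that by (simp add: L_def k_def)
  have P: "P \<in> carrier_mat k k" by (simp add: P_def submat_def lenL k_def)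
  have P_nth: "P $$ (p, q) = R $$ (L ! p, B ! q)" if "p < k" "q < k" for p q
    using that by (simp add: P_def submat_def lenL k_def)
  have Pd: "P $$ (p, p) \<noteq> 0" if "p < k" for p
    using low_nonzero[OF colB(1)[OF that] nz[OF colB(2)[OF that]]] that
    by (simp add: P_nth L_def k_def)
  have Pt: "P $$ (p, q) = 0" if "p < q" "q < k" for p q
    using tri[of p q] that by (simp add: P_nth L_def k_def)
  obtain Q where Q: "mat_inverse P = Some Q" "P * Q = 1\<^sub>m k" "Q \<in> carrier_mat k k"
    using lower_triangular_mat_inverse[OF P Pt Pd] by blast
  define Y where "Y = Q * submat R L C"
  define M where "M = submat R L' C - submat R L' B * Y"
  define R' where "R' = assign R L' C M"
  define R'' where "R'' = assign R' L C (0\<^sub>m (length L) (length C))"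
  define V' where "V' = assign V [0..<dim_row V] C
    (submat V [0..<dim_row V] C - submat V [0..<dim_row V] B * Y)"
  have "distinct L"
  proof -
    have "L ! p \<noteq> L ! q" if "p < q" "q < k" for p q
      using Pt[OF that] Pd[of q] that P_nth[of p q] P_nth[of q q] by auto
    then show ?thesis unfolding distinct_conv_nth lenL by (metis nat_neq_iff)
  qed
  have "distinct L'" by (simp add: L'_def)
  have setL: "r \<in> set L' \<longleftrightarrow> r \<notin> set L" if "r < dim_row R" for r
    using that by (auto simp: L'_def)
  have Y: "Y \<in> carrier_mat k (length C)"
    using Q by (auto simp: Y_def submat_def lenL)
  have PY: "P * Y = submat R L C"
  proof -
    have "submat R L C \<in> carrier_mat k (length C)" by (simp add: submat_def lenL)
    then show ?thesis
      unfolding Y_def using assoc_mult_mat[OF P Q(3), of "submat R L C" "length C"] Q(2) by simp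
  qed
  have prod: "(submat R I B * Y) $$ (p, q) = (\<Sum>b\<in>set B. R $$ (I ! p, b) * Y $$ (pos B b, q))"
    if "p < length I" "q < length C" for I p q
  proof -
    have "(submat R I B * Y) $$ (p, q) = (\<Sum>i<k. R $$ (I ! p, B ! i) * Y $$ (i, q))"
      using that Y by (auto simp: submat_def scalar_prod_def k_def lessThan_atLeast0)
    also have "\<dots> = (\<Sum>i<k. R $$ (I ! p, B ! i) * Y $$ (pos B (B ! i), q))"
      using B by (intro sum.cong) (auto simp: pos_nth k_def)
    also have "\<dots> = (\<Sum>b\<in>set B. R $$ (I ! p, b) * Y $$ (pos B b, q))"
      using bij_betw_nth[OF B(1), of "{..<k}" "set B"]
      by (intro sum.reindex_bij_betw) (auto simp: k_def)
    finally show ?thesis .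
  qed
  have dims: "dim_row R' = dim_row R" "dim_col R' = dim_col R" by (simp_all add: R'_def)
  have zero: "R'' $$ (r, j) = 0" if "r \<in> set L" "j \<in> set C" for r j
  proof -
    obtain p q where "p < k" "r = L ! p" "q < length C" "j = C ! q"
      using \<open>r \<in> set L\<close> \<open>j \<in> set C\<close> lenL by (metis in_set_conv_nth)
    moreover from this have "C ! q < dim_col R" using C(2) nth_mem[of q C] by blast
    ultimately show ?thesis
      using assign_nth[OF \<open>distinct L\<close> C(1), of p q R'] L_less[of p] lenL
      by (simp add: R''_def dims)
  qed
  have eq: "R'' $$ (r, j) = R $$ (r, j) - (\<Sum>b\<in>set B. R $$ (r, b) * Y $$ (pos B b, pos C j))"
    if r: "r < dim_row R" and j: "j \<in> set C" for r j
  proof -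
    obtain q where q: "q < length C" "j = C ! q" using j by (metis in_set_conv_nth)
    have jc: "j < dim_col R" using j C(2) by blast
    have posj: "pos C j = q" using q C(1) by (simp add: pos_nth)
    show ?thesis
    proof (cases "r \<in> set L")
      case True
      then obtain p where p: "p < k" "r = L ! p" using lenL by (metis in_set_conv_nth)
      have "R $$ (r, j) = (P * Y) $$ (p, q)"
        unfolding PY using p q by (simp add: submat_def lenL)
      then show ?thesis using zero[OF True j] prod[of p L q] p q posj by (simp add: P_def lenL)
    next
      case False
      then have "r \<in> set L'" using setL[OF r] by simp
      then obtain p where p: "p < length L'" "r = L' ! p" by (metis in_set_conv_nth)
      have "R'' $$ (r, j) = R' $$ (r, j)"
        unfolding R''_def using False r jc by (intro assign_outside) (auto simp: dims)
      also have "\<dots> = M $$ (p, q)"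
        using assign_nth[OF \<open>distinct L'\<close> C(1) p(1) q(1), of R M] p q r jc by (simp add: R'_def)
      also have "\<dots> = R $$ (r, j) - (submat R L' B * Y) $$ (p, q)"
        using p q Y by (simp add: M_def submat_def)
      finally show ?thesis using prod[of p L' q] p q posj by simp
    qed
  qed
  have "col_update B C (R, V, Z, S) = Some (R'', V', Z, S)"
    using nz Q(1) unfolding P_def
    by (auto simp: Let_def L_def[symmetric] L'_def[symmetric] R''_def R'_def M_def Y_def V'_def)
  moreover have "R'' $$ (r, j) = R $$ (r, j)"
    if "r < dim_row R" "j < dim_col R" "j \<notin> set C" for r j
    using that by (simp add: R''_def R'_def assign_outside)
  moreover have "dim_row R'' = dim_row R" "dim_col R'' = dim_col R"
    by (simp_all add: R''_def R'_def)
  ultimately show ?thesis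
    using that[of R'' V' "\<lambda>b j. Y $$ (pos B b, pos C j)"] eq zero by (simp add: L_def)
qed

section \<open>Invariants of the recursion\<close>

text \<open>
  The columns before \<open>a\<close> are finished: they are nonzero, and their pivot rows are zero in all later
  columns before \<open>b\<close>. For \<open>a = b\<close> this implies that the pivots are distinct.
\<close>
definition eliminated :: "nat \<Rightarrow> nat \<Rightarrow> 'a::zero mat \<Rightarrow> bool" where
  "eliminated a b R \<longleftrightarrow>
     (\<forall>c<a. \<not> zero_col R c) \<and> (\<forall>c j. c < a \<longrightarrow> c < j \<longrightarrow> j < b \<longrightarrow> R $$ (low R c, j) = 0)"

lemma eliminated_mono: "eliminated a b R \<Longrightarrow> a' \<le> a \<Longrightarrow> b' \<le> b \<Longrightarrow> eliminated a' b' R"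
  unfolding eliminated_def by (meson less_le_trans)

definition unit_col :: "nat \<Rightarrow> 'a::zero_neq_one mat \<Rightarrow> nat \<Rightarrow> bool" where
  "unit_col l R j \<longleftrightarrow> (\<forall>r<dim_row R. R $$ (r, j) = (if r = l then 1 else 0))"

text \<open>
  The state while only leaves before \<open>a\<close> have been processed. The members of \<open>S\<close> pair a column that
  was zero with the additional column it was exchanged for. For each of the first \<open>n\<close> columns,
  undoing the swaps gives a \<^const>\<open>monic_combination\<close>, which for a swapped column is zero. The vanishing
  of the entries in the additional rows is what keeps the unit vectors out of all other columns.
\<close>
definition swap_invariant ::
    "'a::field mat \<Rightarrow> nat \<Rightarrow> nat \<Rightarrow> 'a mat \<Rightarrow> (nat \<times> nat) list \<Rightarrow> bool" where
  "swap_invariant D N a R S \<longleftrightarrow>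
     (let n = dim_row D in
       R \<in> carrier_mat (n + N) (n + N) \<and> distinct (map fst S) \<and> distinct (map snd S) \<and>
       (\<forall>(i, l)\<in>set S. i < a \<and> n \<le> l \<and> l < n + N \<and> unit_col l R i \<and> zero_col R l \<and>
          monic_combination D i (\<lambda>_. 0)) \<and>
       (\<forall>l. n \<le> l \<longrightarrow> l < n + N \<longrightarrow> l \<notin> snd ` set S \<longrightarrow> unit_col l R l) \<and>
       (\<forall>j<n. j \<notin> fst ` set S \<longrightarrow>
          (\<forall>r. n \<le> r \<longrightarrow> r < n + N \<longrightarrow> R $$ (r, j) = 0) \<and>
          monic_combination D j (\<lambda>r. R $$ (r, j))))"

lemma
  assumes "swap_invariant D N a R S"
  shows inv_carrier: "R \<in> carrier_mat (dim_row D + N) (dim_row D + N)"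
    and inv_distinct: "distinct (map fst S)" "distinct (map snd S)"
    and inv_swapped: "\<And>i l. (i, l) \<in> set S \<Longrightarrow>
          i < a \<and> dim_row D \<le> l \<and> l < dim_row D + N \<and> unit_col l R i \<and> zero_col R l \<and>
          monic_combination D i (\<lambda>_. 0)"
    and inv_fresh: "\<And>l. dim_row D \<le> l \<Longrightarrow> l < dim_row D + N \<Longrightarrow> l \<notin> snd ` set S \<Longrightarrow> unit_col l R l"
    and inv_lower: "\<And>j r. j < dim_row D \<Longrightarrow> j \<notin> fst ` set S \<Longrightarrow> dim_row D \<le> r \<Longrightarrow>
          r < dim_row D + N \<Longrightarrow> R $$ (r, j) = 0"
    and inv_combination: "\<And>j. j < dim_row D \<Longrightarrow> j \<notin> fst ` set S \<Longrightarrow>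
          monic_combination D j (\<lambda>r. R $$ (r, j))"
  using assms unfolding swap_invariant_def Let_def by auto

lemma inv_mono:
  "swap_invariant D N a R S \<Longrightarrow> a \<le> a' \<Longrightarrow> swap_invariant D N a' R S"
  unfolding swap_invariant_def Let_def by fastforce

lemma unit_col_low:
  assumes "unit_col l R j" "l < dim_row R" "j < dim_col R"
  shows "low R j = l" "\<not> zero_col R j"
  using assms by (auto simp: unit_col_def zero_col_iff intro!: low_eqI)

lemma inv_unit_row:
  assumes inv: "swap_invariant D N a R S" and l: "dim_row D \<le> l" "l < dim_row D + N"
    and j: "j < dim_row D" "(j, l) \<notin> set S"
  shows "R $$ (l, j) = 0"
proof (cases "j \<in> fst ` set S")
  case True
  then obtain l' where "(j, l') \<in> set S" by auto
  then show ?thesis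
    using inv_swapped[OF inv, of j l'] inv_carrier[OF inv] l j by (auto simp: unit_col_def)
next
  case False
  then show ?thesis using inv_lower[OF inv j(1)] l by blast
qed

lemma inv_initial:
  assumes "D \<in> carrier_mat n n"
  shows "swap_invariant D N 0 (four_block_mat D (0\<^sub>m n N) (0\<^sub>m N n) (1\<^sub>m N)) []"
proof -
  have "monic_combination D j
      (\<lambda>r. four_block_mat D (0\<^sub>m n N) (0\<^sub>m N n) (1\<^sub>m N) $$ (r, j))" if "j < n" for j
    using monic_combination_col[of j D] assms that
    by (subst monic_combination_cong[of D _ "\<lambda>r. D $$ (r, j)"]) auto
  then show ?thesis
    using assms by (auto simp: swap_invariant_def unit_col_def)
qed

text \<open>
  The swaps so far belong to different columns before \<open>a < n\<close>, so that they have used up fewer than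
  \<open>N\<close> of the additional columns.
\<close>
lemma inv_fresh_column_exists:
  assumes inv: "swap_invariant D N a R S" and "a < dim_row D" "dim_row D \<le> N"
  shows "\<exists>l. dim_row D \<le> l \<and> l < dim_col R \<and> \<not> zero_col R l"
proof -
  let ?n = "dim_row D"
  have "fst ` set S \<subseteq> {..<a}" using inv_swapped[OF inv] by auto
  then have "card (fst ` set S) \<le> a" using card_mono[of "{..<a}"] by auto
  moreover have "card (snd ` set S) = card (fst ` set S)"
    using inv_distinct[OF inv] by (metis distinct_card length_map set_map)
  ultimately have "card (snd ` set S) < card {?n..<?n + N}" using assms by simp
  then have "\<not> {?n..<?n + N} \<subseteq> snd ` set S"
    using card_mono[of "snd ` set S" "{?n..<?n + N}"] by auto
  then obtain l where "l \<in> {?n..<?n + N}" "l \<notin> snd ` set S" by blast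
  then have "?n \<le> l" "l < ?n + N" "l \<notin> snd ` set S" by auto
  then show ?thesis
    using inv_fresh[OF inv] unit_col_low(2)[of l R l] inv_carrier[OF inv] by auto
qed

lemma col_leaf_correct:
  assumes inv: "swap_invariant D N a R S" and elim: "eliminated a (Suc a) R"
    and n: "dim_row D = n" "a < n" "n \<le> N"
  shows "\<exists>R' V' Z' S'. col_leaf n a (R, V, Z, S) = Some (R', V', Z', S') \<and>
           swap_invariant D N (Suc a) R' S' \<and> eliminated (Suc a) (Suc a) R' \<and>
           (\<forall>r j. r < n + N \<longrightarrow> j < n \<longrightarrow> j \<noteq> a \<longrightarrow> R' $$ (r, j) = R $$ (r, j))"
proof (cases "zero_col R a")
  case False
  then have "eliminated (Suc a) (Suc a) R"
    using elim by (auto simp: eliminated_def less_Suc_eq)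
  then show ?thesis using False inv_mono[OF inv, of "Suc a"] by auto
next
  case True
  note R = inv_carrier[OF inv, unfolded n(1)]
  let ?P = "\<lambda>l. n \<le> l \<and> l < dim_col R \<and> \<not> zero_col R l"
  have ex: "\<exists>l. ?P l" using inv_fresh_column_exists[OF inv] n by auto
  define l where "l = (LEAST l. ?P l)"
  have "?P l" unfolding l_def by (rule LeastI_ex[OF ex])
  then have l: "n \<le> l" "l < n + N" "\<not> zero_col R l" using R by auto
  define R' where "R' = swapcols a l R"
  define S' where "S' = (a, l) # S"
  have l_fresh: "l \<notin> snd ` set S" using l inv_swapped[OF inv] by auto
  have a_fresh: "a \<notin> fst ` set S" using inv_swapped[OF inv] by fastforce
  have R': "R' \<in> carrier_mat (n + N) (n + N)" using R by (simp add: R'_def)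
  have R'_nth: "R' $$ (r, j) = (if j = a then R $$ (r, l) else if j = l then R $$ (r, a)
      else R $$ (r, j))" if "r < n + N" "j < n + N" for r j
    using that R by (simp add: R'_def)
  have unit: "unit_col l R' a"
    using inv_fresh[OF inv, of l] l l_fresh n R R' R'_nth by (simp add: unit_col_def)
  have zero: "zero_col R' l" using True R R' R'_nth n l by (simp add: zero_col_iff)
  have other: "(unit_col i R' j \<longleftrightarrow> unit_col i R j) \<and> (zero_col R' j \<longleftrightarrow> zero_col R j) \<and>
      low R' j = low R j" if "j < n + N" "j \<noteq> a" "j \<noteq> l" for i j
    using that R R' R'_nth by (auto simp: unit_col_def zero_col_iff intro!: low_cong)
  have "swap_invariant D N (Suc a) R' S'"
    unfolding swap_invariant_def Let_def n(1)
  proof (intro conjI ballI allI impI)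
    show "distinct (map fst S')" "distinct (map snd S')"
      using inv_distinct[OF inv] a_fresh l_fresh by (auto simp: S'_def)
    have "monic_combination D a (\<lambda>r. R $$ (r, a))" using inv_combination[OF inv] n a_fresh by simp
    then have comb: "monic_combination D a (\<lambda>_. 0)"
      using True R n by (subst monic_combination_cong[of D _ "\<lambda>r. R $$ (r, a)"])
        (auto simp: zero_col_iff)
    show "case p of (i, k) \<Rightarrow> i < Suc a \<and> n \<le> k \<and> k < n + N \<and> unit_col k R' i \<and>
        zero_col R' k \<and> monic_combination D i (\<lambda>_. 0)" if p: "p \<in> set S'" for p
    proof (cases "p = (a, l)")
      case True
      then show ?thesis using comb unit zero l by simp
    next
      case False
      then obtain i k where ik: "p = (i, k)" "(i, k) \<in> set S" using p by (cases p) (auto simp: S'_def)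
      then have "k \<noteq> l" "k \<noteq> a" "i \<noteq> a" "i \<noteq> l"
        using l l_fresh n inv_swapped[OF inv ik(2)] by force+
      then show ?thesis using inv_swapped[OF inv ik(2)] other[of i] other[of k] ik n by auto
    qed
    show "unit_col k R' k" if "n \<le> k" "k < n + N" "k \<notin> snd ` set S'" for k
      using that inv_fresh[OF inv, of k] other[of k] n by (auto simp: S'_def)
    show "R' $$ (r, j) = 0" if "j < n" "j \<notin> fst ` set S'" "n \<le> r" "r < n + N" for j r
      using that inv_lower[OF inv, of j r] l n by (auto simp: S'_def R'_nth)
    show "monic_combination D j (\<lambda>r. R' $$ (r, j))" if "j < n" "j \<notin> fst ` set S'" for j
      using that inv_combination[OF inv, of j] l n R'_nth
      by (subst monic_combination_cong[of D _ "\<lambda>r. R $$ (r, j)"]) (auto simp: S'_def)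
  qed (use R' in auto)
  moreover have "eliminated (Suc a) (Suc a) R'"
    unfolding eliminated_def
  proof (intro conjI allI impI)
    show "\<not> zero_col R' c" if "c < Suc a" for c
      using that other[of c] elim l n unit_col_low(2)[OF unit] R'
      by (cases "c = a") (auto simp: eliminated_def)
    show "R' $$ (low R' c, j) = 0" if c: "c < Suc a" "c < j" "j < Suc a" for c j
    proof -
      have ca: "c < a" "\<not> zero_col R c" using c elim by (auto simp: eliminated_def)
      then have low: "low R c < n + N" "R $$ (low R c, c) \<noteq> 0"
        using low_less[of c R] low_nonzero[of c R] R n by auto
      have low': "low R' c = low R c" using other[of c] ca l n by auto
      show ?thesis
      proof (cases "j = a")
        case True
        \<comment> \<open>The rows of the fresh unit columns vanish in all the other columns, so that
          \<^term>\<open>l\<close> is not a pivot row yet.\<close>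
        have "R $$ (l, c) = 0" using inv_unit_row[OF inv, of l c] l l_fresh ca n by force
        then have "low R c \<noteq> l" using low by auto
        then show ?thesis using unit low low' True R' by (auto simp: unit_col_def)
      next
        case False
        then have "R' $$ (low R c, j) = R $$ (low R c, j)"
          using R'_nth[of "low R c" j] low c l n by auto
        then show ?thesis using low' elim c ca by (auto simp: eliminated_def)
      qed
    qed
  qed
  moreover have "R' $$ (r, j) = R $$ (r, j)" if "r < n + N" "j < n" "j \<noteq> a" for r j
    using R'_nth[of r j] that l by auto
  ultimately show ?thesis
    using True ex by (auto simp: Let_def l_def[symmetric] R'_def S'_def)
qed

text \<open>
  The assumption \<open>eliminated a b R\<close> concerns the pivot rows from before the interval: they are
  zero in both halves, hence remain zero in the second one.
\<close>
lemma col_update_correct: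
  assumes inv: "swap_invariant D N m R S" and elim: "eliminated m m R" "eliminated a b R"
    and D: "D \<in> carrier_mat n n" and le: "a \<le> m" "m \<le> b" "b \<le> n"
  shows "\<exists>R' V'. col_update [a..<m] [m..<b] (R, V, Z, S) = Some (R', V', Z, S) \<and>
           swap_invariant D N m R' S \<and> eliminated m b R' \<and>
           (\<forall>r j. r < n + N \<longrightarrow> j < n \<longrightarrow> j \<notin> {m..<b} \<longrightarrow> R' $$ (r, j) = R $$ (r, j))"
proof -
  have n: "dim_row D = n" "dim_col D = n" using D by auto
  note R = inv_carrier[OF inv, unfolded n(1)]
  have nz: "\<not> zero_col R c" if "c < m" for c using elim(1) that by (auto simp: eliminated_def)
  have low_lt: "low R c < n + N" if "c < m" for c
    using low_less[of c R] nz[OF that] that le R by auto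
  have tri: "R $$ (low R ([a..<m] ! p), [a..<m] ! q) = 0" if "p < q" "q < length [a..<m]" for p q
    using elim(1) that by (auto simp: eliminated_def)
  have block: "distinct [a..<m]" "set [a..<m] \<subseteq> {..<dim_col R}" "distinct [m..<b]"
    "set [m..<b] \<subseteq> {..<dim_col R}" "\<And>k. k \<in> set [a..<m] \<Longrightarrow> \<not> zero_col R k"
    using R le nz by auto
  obtain R' V' c where upd: "col_update [a..<m] [m..<b] (R, V, Z, S) = Some (R', V', Z, S)"
    and dims: "dim_row R' = dim_row R" "dim_col R' = dim_col R"
    and same: "\<And>r j. r < dim_row R \<Longrightarrow> j < dim_col R \<Longrightarrow> j \<notin> set [m..<b] \<Longrightarrow>
           R' $$ (r, j) = R $$ (r, j)"
    and diff: "\<And>r j. r < dim_row R \<Longrightarrow> j \<in> set [m..<b] \<Longrightarrow>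
           R' $$ (r, j) = R $$ (r, j) - (\<Sum>k\<in>set [a..<m]. R $$ (r, k) * c k j)"
    and zero: "\<And>k j. k \<in> set [a..<m] \<Longrightarrow> j \<in> set [m..<b] \<Longrightarrow> R' $$ (low R k, j) = 0"
    by (rule col_update_eliminates[OF block tri, of V Z S]) (assumption+, rule that, assumption+)
  have R': "R' \<in> carrier_mat (n + N) (n + N)" using R dims by auto
  have same': "R' $$ (r, j) = R $$ (r, j)" if "r < n + N" "j < n + N" "j < m \<or> b \<le> j" for r j
    using same[of r j] that R by auto
  have low': "low R' k = low R k" "zero_col R' k \<longleftrightarrow> zero_col R k" if "k < m" for k
    using that le R R' same' by (auto simp: zero_col_iff intro!: low_cong)
  have other: "(unit_col i R' j \<longleftrightarrow> unit_col i R j) \<and> (zero_col R' j \<longleftrightarrow> zero_col R j)"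
    if "j < n + N" "j < m \<or> b \<le> j" for i j
    using that R R' same' by (auto simp: unit_col_def zero_col_iff)
  \<comment> \<open>Among the first \<^term>\<open>n\<close> columns, a column \<^term>\<open>k\<close> that was swapped in is the only one with
    an entry in its pivot row, so that clearing that row takes the coefficient zero.\<close>
  have coeff0: "c k j = 0" if k: "k \<in> {a..<m}" "k \<in> fst ` set S" and j: "j \<in> {m..<b}" for k j
  proof -
    obtain l where kl: "(k, l) \<in> set S" using k by auto
    note l = inv_swapped[OF inv kl, unfolded n]
    have row: "R $$ (l, k') = (if k' = k then 1 else 0)" if "k' < n" for k'
    proof (cases "k' = k")
      case False
      have "(k', l) \<notin> set S"
        using kl False inv_distinct(2)[OF inv] inj_onD[of snd "set S" "(k', l)" "(k, l)"]
        by (auto simp: distinct_map)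
      then show ?thesis using inv_unit_row[OF inv, of l k'] l that n False by auto
    qed (use l R in \<open>auto simp: unit_col_def\<close>)
    have "low R k = l" using unit_col_low(1)[of l R k] l R k le by auto
    then have "0 = R $$ (l, j) - (\<Sum>k'\<in>{a..<m}. R $$ (l, k') * c k' j)"
      using zero[of k j] diff[of l j] k j l R by auto
    also have "R $$ (l, j) = 0" using row[of j] j k le by auto
    also have "(\<Sum>k'\<in>{a..<m}. R $$ (l, k') * c k' j) = (\<Sum>k'\<in>{a..<m}. if k' = k then c k j else 0)"
      using row le by (intro sum.cong) auto
    also have "\<dots> = c k j" using k by simp
    finally show ?thesis by simp
  qed
  have unswapped: "j \<notin> fst ` set S" if "m \<le> j" for j using inv_swapped[OF inv] that by fastforce
  have diff': "R' $$ (r, j) = R $$ (r, j) - (\<Sum>k\<in>{a..<m} - fst ` set S. R $$ (r, k) * c k j)"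
    if "r < n + N" "j \<in> {m..<b}" for r j
  proof -
    have "(\<Sum>k\<in>{a..<m}. R $$ (r, k) * c k j) = (\<Sum>k\<in>{a..<m} - fst ` set S. R $$ (r, k) * c k j)"
      using coeff0 that by (intro sum.mono_neutral_right) auto
    then show ?thesis using diff[of r j] that R by simp
  qed
  have "swap_invariant D N m R' S"
    unfolding swap_invariant_def Let_def n(1)
  proof (intro conjI ballI allI impI)
    show "distinct (map fst S)" "distinct (map snd S)" using inv_distinct[OF inv] by auto
    show "case p of (i, l) \<Rightarrow> i < m \<and> n \<le> l \<and> l < n + N \<and> unit_col l R' i \<and> zero_col R' l \<and>
        monic_combination D i (\<lambda>_. 0)" if "p \<in> set S" for p
      using inv_swapped[OF inv, of "fst p" "snd p"] that other[of "fst p"] other[of "snd p"] le n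
      by (cases p) auto
    show "unit_col l R' l" if "n \<le> l" "l < n + N" "l \<notin> snd ` set S" for l
      using that inv_fresh[OF inv, of l] other[of l] le n by auto
    fix j assume j: "j < n" "j \<notin> fst ` set S"
    show "R' $$ (r, j) = 0" if r: "n \<le> r" "r < n + N" for r
    proof (cases "j \<in> {m..<b}")
      case True
      then show ?thesis using diff'[of r j] inv_lower[OF inv, of _ r] j r le n by simp
    next
      case False
      then show ?thesis using same'[of r j] inv_lower[OF inv, of j r] j r n by auto
    qed
    show "monic_combination D j (\<lambda>r. R' $$ (r, j))"
    proof (cases "j \<in> {m..<b}")
      case True
      have "monic_combination D j
          (\<lambda>r. R $$ (r, j) - (\<Sum>k\<in>{a..<m} - fst ` set S. R $$ (r, k) * c k j))"
        using inv_combination[OF inv] j n True le by (intro monic_combination_diff) auto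
      then show ?thesis using diff' True n
        by (subst monic_combination_cong[of D _ "\<lambda>r. R $$ (r, j)
            - (\<Sum>k\<in>{a..<m} - fst ` set S. R $$ (r, k) * c k j)"]) auto
    next
      case False
      then show ?thesis using inv_combination[OF inv] j n same'
        by (subst monic_combination_cong[of D _ "\<lambda>r. R $$ (r, j)"]) auto
    qed
  qed (use R' in auto)
  moreover have "eliminated m b R'"
    unfolding eliminated_def
  proof (intro conjI allI impI)
    show "\<not> zero_col R' k" if "k < m" for k using nz low' that by simp
    show "R' $$ (low R' k, j) = 0" if k: "k < m" "k < j" "j < b" for k j
    proof -
      consider "j < m" | "m \<le> j" "a \<le> k" | "m \<le> j" "k < a" by linarith
      then show ?thesis
      proof cases
        case 1
        then show ?thesis using same'[of "low R k" j] low_lt k low' elim(1) le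
          by (auto simp: eliminated_def)
      next
        case 2
        then show ?thesis using zero[of k j] k low' by auto
      next
        case 3
        \<comment> \<open>This row is zero in both halves of the interval, so the subtraction keeps it zero.\<close>
        then have "R $$ (low R k, j') = 0" if "j' \<in> {a..<b}" for j'
          using elim(2) that by (auto simp: eliminated_def)
        then show ?thesis using diff[of "low R k" j] 3 k low' low_lt[of k] R le by simp
      qed
    qed
  qed
  ultimately show ?thesis using upd same' le by auto
qed

declare col_rec.simps [simp del]

text \<open>
  That all other columns among the first \<open>n\<close> stay the same is part of the induction: after the first
  half is processed, the second half must still be zero in the pivot rows from before the
  interval.
\<close>
lemma col_rec_correct:
  fixes D :: "'a::field mat"
  assumes D: "D \<in> carrier_mat n n" and N: "n \<le> N"
    and "swap_invariant D N a R S" "eliminated a b R" "a \<le> b" "b \<le> n"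
  shows "\<exists>R' V' Z' S'. col_rec n a b (R, V, Z, S) = Some (R', V', Z', S') \<and>
           swap_invariant D N b R' S' \<and> eliminated b b R' \<and>
           (\<forall>r j. r < n + N \<longrightarrow> j < n \<longrightarrow> j \<notin> {a..<b} \<longrightarrow> R' $$ (r, j) = R $$ (r, j))"
  using assms(3-6)
proof (induction "b - a" arbitrary: a b R V Z S rule: less_induct)
  case less
  have n: "dim_row D = n" using D by auto
  consider "a = b" | "b = Suc a" | "Suc a < b" using less.prems by linarith
  then show ?case
  proof cases
    case 1
    then show ?thesis using less.prems by (auto simp: col_rec.simps)
  next
    case 2
    then show ?thesis
      using col_leaf_correct[of D N a R S n V Z] less.prems N n by (auto simp: col_rec.simps simp del: col_leaf.simps)
  next
    case 3
    define m where "m = (a + b) div 2"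
    have m: "a < m" "m < b" using 3 by (auto simp: m_def)
    then have shorter: "m - a < b - a" "b - m < b - a" by auto
    \<comment> \<open>The first recursive call leaves the columns from \<^term>\<open>m\<close> on unchanged, and also the pivots
      before \<^term>\<open>a\<close>; hence those pivot rows are still cleared up to \<^term>\<open>b\<close>.\<close>
    have same_elim: "eliminated a b R'" if inv: "swap_invariant D N m R' S'"
      and el: "eliminated m m R'" and old: "eliminated a b R" "swap_invariant D N a R S"
      and same: "\<forall>r j. r < n + N \<longrightarrow> j < n \<longrightarrow> j \<notin> {a..<m} \<longrightarrow> R' $$ (r, j) = R $$ (r, j)"
      and b: "b \<le> n" for R' S'
    proof -
      note R = inv_carrier[OF old(2), unfolded n] inv_carrier[OF inv, unfolded n]
      have lowR: "low R' c = low R c" "low R c < n + N" if "c < a" for c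
      proof -
        show "low R' c = low R c" using R same that m b by (intro low_cong) auto
        show "low R c < n + N"
          using low_less[of c R] old(1) that R m b by (auto simp: eliminated_def)
      qed
      have "R' $$ (low R' c, j) = 0" if c: "c < a" "c < j" "j < b" for c j
      proof (cases "j < m")
        case True
        then show ?thesis using el c m by (auto simp: eliminated_def)
      next
        case False
        then show ?thesis using same lowR[OF c(1)] c b old(1) by (auto simp: eliminated_def)
      qed
      then show ?thesis using el m by (auto simp: eliminated_def)
    qed
    obtain R1 V1 Z1 S1 where 1: "col_rec n a m (R, V, Z, S) = Some (R1, V1, Z1, S1)"
      "swap_invariant D N m R1 S1" "eliminated m m R1"
      "\<forall>r j. r < n + N \<longrightarrow> j < n \<longrightarrow> j \<notin> {a..<m} \<longrightarrow> R1 $$ (r, j) = R $$ (r, j)"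
      using less.hyps[OF shorter(1), of R S V Z] less.prems m eliminated_mono[of a b R a m] by auto
    obtain R2 V2 where 2:
      "col_update [a..<m] [m..<b] (R1, V1, Z1, S1) = Some (R2, V2, Z1, S1)"
      "swap_invariant D N m R2 S1" "eliminated m b R2"
      "\<forall>r j. r < n + N \<longrightarrow> j < n \<longrightarrow> j \<notin> {m..<b} \<longrightarrow> R2 $$ (r, j) = R1 $$ (r, j)"
      using col_update_correct[OF 1(2,3) same_elim[OF 1(2,3) _ _ 1(4)] D, of V1 Z1]
        less.prems m by auto
    obtain R3 V3 Z3 S3 where 3: "col_rec n m b (R2, V2, Z1, S1) = Some (R3, V3, Z3, S3)"
      "swap_invariant D N b R3 S3" "eliminated b b R3"
      "\<forall>r j. r < n + N \<longrightarrow> j < n \<longrightarrow> j \<notin> {m..<b} \<longrightarrow> R3 $$ (r, j) = R2 $$ (r, j)"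
      using less.hyps[OF shorter(2) 2(2,3), of V2 Z1] less.prems m by auto
    have "col_rec n a b (R, V, Z, S) = Some (R3, V3, Z3, S3)"
      using m 1(1) 2(1) 3(1) m_def
      by (subst col_rec.simps) (simp add: Let_def del: col_update.simps)
    moreover have "R3 $$ (r, j) = R $$ (r, j)" if "r < n + N" "j < n" "j \<notin> {a..<b}" for r j
      using that 1(4) 2(4) 3(4) m by auto
    ultimately show ?thesis using 3(2,3) by blast
  qed
qed

section \<open>Undoing the swaps\<close>

lemma undo_swaps_dim [simp]:
  "dim_row (undo_swaps S R) = dim_row R" "dim_col (undo_swaps S R) = dim_col R"
  unfolding undo_swaps_def by (induction S arbitrary: R) auto

text \<open>
  The swaps are disjoint transpositions, so that the order in which they are undone does not
  affect the result.
\<close>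
lemma undo_swaps_nth:
  assumes "distinct (map fst S)" "distinct (map snd S)"
    and "\<And>i l. (i, l) \<in> set S \<Longrightarrow> i < n \<and> n \<le> l \<and> l < dim_col R"
    and "r < dim_row R" "j < n" "n \<le> dim_col R"
  shows "undo_swaps S R $$ (r, j) = (case map_of S j of None \<Rightarrow> R $$ (r, j) | Some l \<Rightarrow> R $$ (r, l))"
  using assms
proof (induction S arbitrary: R)
  case Nil
  then show ?case by (simp add: undo_swaps_def)
next
  case (Cons p S)
  obtain i l where p: "p = (i, l)" by (cases p)
  have il: "i < n" "n \<le> l" "l < dim_col R" using Cons.prems(3)[of i l] p by auto
  have step: "undo_swaps (p # S) R = undo_swaps S (swapcols i l R)"
    by (simp add: undo_swaps_def p)
  have IH: "undo_swaps S (swapcols i l R) $$ (r, j) = (case map_of S j of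
      None \<Rightarrow> swapcols i l R $$ (r, j) | Some k \<Rightarrow> swapcols i l R $$ (r, k))"
    using Cons.prems by (intro Cons.IH) auto
  show ?case
  proof (cases "map_of S j")
    case None
    then show ?thesis using Cons.prems il unfolding step IH by (auto simp: p)
  next
    case (Some k)
    then have k: "(j, k) \<in> set S" by (rule map_of_SomeD)
    then have "i \<noteq> j" "l \<noteq> k" using Cons.prems(1,2) by (force simp: p)+
    have "n \<le> k" "k < dim_col R" using Cons.prems(3)[of j k] k by auto
    then have "swapcols i l R $$ (r, k) = R $$ (r, k)"
      using il Cons.prems(4) \<open>l \<noteq> k\<close> by (subst index_mat_swapcols) auto
    then show ?thesis using \<open>i \<noteq> j\<close> Some unfolding step IH by (simp add: p)
  qed
qed

text \<open>
  In the final state all of the first \<open>n\<close> columns are nonzero with distinct pivots. Undoing the swaps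
  turns the swapped ones into zero columns and leaves the others as they are. The latter vanish in
  the additional rows, so that the restriction to \<open>n\<close> rows keeps their pivots.
\<close>
theorem recursive_column_algorithm_reduction:
  fixes D :: "'a::field mat"
  assumes D: "D \<in> carrier_mat n n" and N: "n \<le> N"
  shows "\<exists>R V. recursive_column_algorithm N D = Some R \<and> reduction D R V"
proof -
  have n: "dim_row D = n" "dim_col D = n" using D by auto
  let ?R0 = "four_block_mat D (0\<^sub>m n N) (0\<^sub>m N n) (1\<^sub>m N)"
  have "eliminated 0 n ?R0" by (simp add: eliminated_def)
  then obtain R V Z S where run: "col_rec n 0 n (?R0, 1\<^sub>m (n + N), {}, []) = Some (R, V, Z, S)"
    and inv: "swap_invariant D N n R S" and elim: "eliminated n n R"
    using col_rec_correct[OF D N inv_initial[OF D], of n "1\<^sub>m (n + N)" "{}"] by auto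
  note R = inv_carrier[OF inv, unfolded n]
  define X where "X = submat (undo_swaps S R) [0..<n] [0..<n]"
  have dims: "dim_row X = n" "dim_col X = n" by (auto simp: X_def submat_def)
  have X_nth: "X $$ (r, j) = (if j \<in> fst ` set S then 0 else R $$ (r, j))"
    if "r < n" "j < n" for r j
  proof -
    have "X $$ (r, j) = undo_swaps S R $$ (r, j)" using that by (simp add: X_def submat_def)
    also have "\<dots> = (case map_of S j of None \<Rightarrow> R $$ (r, j) | Some l \<Rightarrow> R $$ (r, l))"
      using inv_swapped[OF inv] inv_distinct[OF inv] n R that by (intro undo_swaps_nth) auto
    also have "\<dots> = (if j \<in> fst ` set S then 0 else R $$ (r, j))"
    proof (cases "map_of S j")
      case None
      then show ?thesis using map_of_eq_None_iff[of S j] by simp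
    next
      case (Some l)
      then have "(j, l) \<in> set S" by (rule map_of_SomeD)
      then show ?thesis
        using Some inv_swapped[OF inv, of j l] R n that by (force simp: zero_col_iff)
    qed
    finally show ?thesis .
  qed
  have comb: "monic_combination D j (\<lambda>r. X $$ (r, j))" if j: "j < n" for j
  proof (cases "j \<in> fst ` set S")
    case True
    then obtain l where "(j, l) \<in> set S" by auto
    then have "monic_combination D j (\<lambda>_. 0)" using inv_swapped[OF inv] by blast
    then show ?thesis using X_nth n j True
      by (subst monic_combination_cong[of D _ "\<lambda>_. 0"]) auto
  next
    case False
    then show ?thesis using X_nth n j inv_combination[OF inv, of j]
      by (subst monic_combination_cong[of D _ "\<lambda>r. R $$ (r, j)"]) auto
  qed
  have lowX: "low X j = low R j \<and> low R j < n \<and> R $$ (low R j, j) \<noteq> 0"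
    if j: "j < n" "\<not> zero_col X j" for j
  proof -
    have fresh: "j \<notin> fst ` set S"
    proof
      assume "j \<in> fst ` set S"
      then have "X $$ (r, j) = 0" if "r < n" for r using X_nth[of r j] that j by simp
      then show False using j dims by (simp add: zero_col_iff)
    qed
    have "\<not> zero_col R j" using elim j by (auto simp: eliminated_def)
    then have low: "low R j < n + N" "R $$ (low R j, j) \<noteq> 0"
      using low_less[of j R] low_nonzero[of j R] j R by auto
    then have "low R j < n" using inv_lower[OF inv, of j "low R j"] fresh j n by (meson not_le)
    moreover have "X $$ (i, j) = 0" if "low R j < i" "i < n" for i
      using le_low[of i R j] that X_nth[of i j] fresh j R by force
    ultimately show ?thesis
      using low X_nth fresh j dims by (auto intro!: low_eqI)
  qed
  have "column_reduced X"
  proof -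
    have "low X j \<noteq> low X k" if "j < k" "k < n" "\<not> zero_col X j" "\<not> zero_col X k" for j k
      using that lowX[of j] lowX[of k] elim by (force simp: eliminated_def)
    then show ?thesis unfolding column_reduced_def dims by (metis nat_neq_iff)
  qed
  then obtain V where "reduction D X V"
    using reduction_of_monic_combinations[of X D] dims n comb by auto
  moreover have "recursive_column_algorithm N D = Some X"
    using run n by (simp add: recursive_column_algorithm_def initial_state_def Let_def X_def)
  ultimately show ?thesis by blast
qed

theorem theorem4p5:
  fixes K :: "nat \<Rightarrow> 'v::linorder set set" and n N :: nat
  assumes "filtration n K" and "n \<le> N"
  shows "\<exists>R. recursive_column_algorithm N (boundary_matrix n K :: 'a::field mat) = Some R \<and>
             diagram R = persistence_diagram TYPE('a) n K"
proof -
  let ?D = "boundary_matrix n K :: 'a mat"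
  have "?D \<in> carrier_mat n n" by (simp add: boundary_matrix_def)
  then obtain R V where R: "recursive_column_algorithm N ?D = Some R" "reduction ?D R V"
    using recursive_column_algorithm_reduction assms(2) by blast
  have "persistence_diagram TYPE('a) n K = diagram R"
    unfolding persistence_diagram_def
    using R(2) reduction_diagram_unique by (intro the_equality) blast+
  with R(1) show ?thesis by auto
qed

end
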